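(* Let $V$ be the $5$-dimensional real vector space with basis $\sigma_1,\dots,\sigma_5$, let $W\subset\wedge^2V$ be the subspace spanned by $\sigma_1\wedge\sigma_4-\sigma_2\wedge\sigma_3$, $\sigma_1\wedge\sigma_5-\sigma_2\wedge\sigma_4$ and $\sigma_2\wedge\sigma_5-\sigma_3\wedge\sigma_4$, and let $\mathcal{G}=V\oplus V'$ with $V'=(\wedge^2V)/W$ be the $2$-step nilpotent Lie algebra whose bracket is determined by $[v_1,v_2]=v_1\wedge v_2 \bmod W$ for $v_1,v_2\in V$ and $[x,y]=0$ for $x\in\mathcal{G}$, $y\in V'$. Let $G$ be the simply connected nilpotent Lie group with Lie algebra $\mathcal{G}$. Then the action of $\mathrm{Aut}(G)$ on $G$ has no dense orbit.
   Context: $\mathrm{Aut}(G)$ is the group of all continuous automorphisms of $G$. (In the paper $V$ is realised as the space of real symmetric $3\times3$ matrices $(\sigma_{kl})$ with $\sigma_{22}=2\sigma_{13}$, with $\sigma_1=2E_{11}$, $\sigma_2=E_{12}+E_{21}$, $\sigma_3=E_{13}+2E_{22}+E_{31}$, $\sigma_4=E_{23}+E_{32}$, $\sigma_5=2E_{33}$, where $E_{kl}$ are the matrix units.) *)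

theory Defs
  imports "HOL-Analysis.Analysis" "HOL-Algebra.Group_Action"
begin

section \<open>The exterior square and its quotient\<close>

text \<open>
  The tensor square of \<open>real^'n\<close> is \<open>real^'n^'n\<close>, with \<open>v \<otimes> w\<close> the matrix
  \<open>(v\<^sub>i w\<^sub>j)\<close>.  The exterior square is realised in it by alternating tensors, with
  \<open>v \<and> w = v \<otimes> w - w \<otimes> v\<close>.
\<close>

definition wedge :: "real^'n \<Rightarrow> real^'n \<Rightarrow> real^'n^'n" where
  "wedge v w = (\<chi> i j. v $ i * w $ j - w $ i * v $ j)"

definition exterior_square :: "(real^'n^'n) set" where
  "exterior_square = span {wedge v w | v w. True}"

text \<open>The index type \<open>5\<close> consists of the residues modulo 5, so \<open>\<sigma> 5\<close> is \<open>\<sigma> 0\<close>, and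
  \<open>\<sigma> 1, \<dots>, \<sigma> 5\<close> is the standard basis.\<close>

definition \<sigma> :: "5 \<Rightarrow> real^5" where
  "\<sigma> k = axis k 1"

definition W :: "(real^5^5) set" where
  "W = span {wedge (\<sigma> 1) (\<sigma> 4) - wedge (\<sigma> 2) (\<sigma> 3),
             wedge (\<sigma> 1) (\<sigma> 5) - wedge (\<sigma> 2) (\<sigma> 4),
             wedge (\<sigma> 2) (\<sigma> 5) - wedge (\<sigma> 3) (\<sigma> 4)}"

definition eq_mod_W :: "real^5^5 \<Rightarrow> real^5^5 \<Rightarrow> bool" where
  "eq_mod_W A B \<longleftrightarrow> A \<in> exterior_square \<and> B \<in> exterior_square \<and> A - B \<in> W"

lemma wedge_in_exterior_square: "wedge v w \<in> exterior_square"
  unfolding exterior_square_def by (rule span_base) blast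

lemma subspace_exterior_square: "subspace exterior_square"
  by (simp add: exterior_square_def)

lemma subspace_W: "subspace W"
  by (simp add: W_def)

lemma W_subset_exterior_square: "W \<subseteq> exterior_square"
  unfolding W_def
  by (rule span_minimal)
     (auto intro!: subspace_diff subspace_exterior_square wedge_in_exterior_square)

lemma exterior_square_eq_skew: "exterior_square = {A :: real^'n^'n. transpose A = - A}"
proof
  have "subspace {A :: real^'n^'n. transpose A = - A}"
  proof -
    have "linear (\<lambda>A :: real^'n^'n. transpose A + A)"
      by (auto intro!: linearI simp: transpose_def vec_eq_iff algebra_simps)
    from linear_subspace_kernel[OF this] show ?thesis
      by (simp add: eq_neg_iff_add_eq_0)
  qed
  moreover have "{wedge v w | v w. True} \<subseteq> {A :: real^'n^'n. transpose A = - A}"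
    by (auto simp: wedge_def transpose_def vec_eq_iff)
  ultimately show "exterior_square \<subseteq> {A :: real^'n^'n. transpose A = - A}"
    unfolding exterior_square_def by (intro span_minimal)
  show "{A :: real^'n^'n. transpose A = - A} \<subseteq> exterior_square"
  proof
    fix A :: "real^'n^'n" assume "A \<in> {A. transpose A = - A}"
    then have A: "transpose A = - A" by simp
    have skew: "A $ i $ j = - (A $ j $ i)" for i j
    proof -
      have "A $ i $ j = transpose A $ j $ i" by (simp add: transpose_def)
      also have "\<dots> = - (A $ j $ i)" by (subst A) simp
      finally show ?thesis .
    qed
    have "(\<Sum>a\<in>UNIV. \<Sum>b\<in>UNIV. ((A $ a $ b) / 2) *\<^sub>R wedge (axis a 1) (axis b 1)) $ i $ j = A $ i $ j"
      (is "?S $ i $ j = _") for i j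
    proof -
      have "?S $ i $ j = (\<Sum>a\<in>UNIV. \<Sum>b\<in>UNIV.
          (if a = i then (if b = j then A $ a $ b / 2 else 0) else 0)
        - (if a = j then (if b = i then A $ a $ b / 2 else 0) else 0))"
        by (auto simp: wedge_def axis_def intro!: sum.cong)
      also have "\<dots> = (\<Sum>a\<in>UNIV. (if a = i then A $ a $ j / 2 else 0) - (if a = j then A $ a $ i / 2 else 0))"
        by (rule sum.cong) (auto simp: sum_subtractf)
      also have "\<dots> = A $ i $ j / 2 - A $ j $ i / 2"
        by (simp add: sum_subtractf)
      also have "\<dots> = A $ i $ j"
        using skew[of j i] by simp
      finally show ?thesis .
    qed
    then have "A = (\<Sum>a\<in>UNIV. \<Sum>b\<in>UNIV. ((A $ a $ b) / 2) *\<^sub>R wedge (axis a 1) (axis b 1))"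
      unfolding vec_eq_iff by metis
    moreover have "\<dots> \<in> exterior_square"
      by (intro subspace_sum subspace_mul subspace_exterior_square wedge_in_exterior_square)
    ultimately show "A \<in> exterior_square" by simp
  qed
qed

quotient_type ext_quot = "real^5^5" / partial: eq_mod_W
proof (rule part_equivpI)
  show "\<exists>A. eq_mod_W A A"
    using subspace_0[OF subspace_W] subspace_0[OF subspace_exterior_square]
    by (auto simp: eq_mod_W_def)
  show "symp eq_mod_W"
    using subspace_neg[OF subspace_W] by (fastforce simp: eq_mod_W_def symp_def)
  show "transp eq_mod_W"
    using subspace_add[OF subspace_W] by (fastforce simp: eq_mod_W_def transp_def)
qed

lemma infdist_W_cong:
  assumes "A - B \<in> W"
  shows "infdist A W = infdist B W"
proof -
  have le: "infdist A W \<le> infdist B W" if "A - B \<in> W" for A B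
  proof -
    obtain C where C: "C \<in> W" "infdist B W = dist B C"
      using infdist_attains_inf[of W B] subspace_W subspace_0[OF subspace_W]
      by (metis closed_subspace empty_iff)
    have "C + (A - B) \<in> W" using C that subspace_W by (simp add: subspace_add)
    then have "infdist A W \<le> dist A (C + (A - B))" by (rule infdist_le)
    also have "\<dots> = dist B C" by (simp add: dist_norm)
    finally show ?thesis using C by simp
  qed
  have "B - A \<in> W" using subspace_neg[OF subspace_W assms] by simp
  then show ?thesis using le[OF assms] le[of B A] by simp
qed

instantiation ext_quot :: real_normed_vector
begin

lift_definition zero_ext_quot :: ext_quot is 0
  by (simp add: eq_mod_W_def subspace_0 subspace_W subspace_exterior_square)

lift_definition plus_ext_quot :: "ext_quot \<Rightarrow> ext_quot \<Rightarrow> ext_quot" is "(+)"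
  by (auto simp: eq_mod_W_def add_diff_add
      intro!: subspace_add subspace_W subspace_exterior_square)

lift_definition uminus_ext_quot :: "ext_quot \<Rightarrow> ext_quot" is uminus
  using subspace_neg[OF subspace_W] subspace_neg[OF subspace_exterior_square]
  by (fastforce simp: eq_mod_W_def)

lift_definition minus_ext_quot :: "ext_quot \<Rightarrow> ext_quot \<Rightarrow> ext_quot" is "(-)"
proof -
  fix A A' B B' assume *: "eq_mod_W A A'" "eq_mod_W B B'"
  have "(A - B) - (A' - B') = (A - A') - (B - B')" by simp
  with * show "eq_mod_W (A - B) (A' - B')"
    unfolding eq_mod_W_def by (metis subspace_diff subspace_W subspace_exterior_square)
qed

lift_definition scaleR_ext_quot :: "real \<Rightarrow> ext_quot \<Rightarrow> ext_quot" is scaleR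
  by (auto simp: eq_mod_W_def simp flip: scaleR_diff_right
      intro!: subspace_mul subspace_W subspace_exterior_square)

text \<open>The quotient norm; it induces the only Hausdorff vector space topology, as the space is
  finite-dimensional.\<close>

lift_definition norm_ext_quot :: "ext_quot \<Rightarrow> real" is "\<lambda>A. infdist A W"
  by (auto simp: eq_mod_W_def intro: infdist_W_cong)

definition dist_ext_quot :: "ext_quot \<Rightarrow> ext_quot \<Rightarrow> real" where
  "dist_ext_quot x y = norm (x - y)"

definition sgn_ext_quot :: "ext_quot \<Rightarrow> ext_quot" where
  "sgn_ext_quot x = inverse (norm x) *\<^sub>R x"

definition uniformity_ext_quot :: "(ext_quot \<times> ext_quot) filter" where
  "uniformity_ext_quot = (INF e\<in>{0<..}. principal {(x, y). dist x y < e})"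

definition open_ext_quot :: "ext_quot set \<Rightarrow> bool" where
  "open_ext_quot U \<longleftrightarrow> (\<forall>x\<in>U. eventually (\<lambda>(x', y). x' = x \<longrightarrow> y \<in> U) uniformity)"

instance
proof
  note [simp] = subspace_0[OF subspace_W] subspace_0[OF subspace_exterior_square]
  note [intro!] = subspace_add[OF subspace_W] subspace_add[OF subspace_exterior_square]
    subspace_mul[OF subspace_W] subspace_mul[OF subspace_exterior_square]
    subspace_diff[OF subspace_exterior_square] subspace_neg[OF subspace_exterior_square]
  have W: "closed W" "W \<noteq> {}"
    using subspace_W by (auto simp: closed_subspace dest: subspace_0)
  have att: "\<exists>C\<in>W. infdist A W = dist A C" for A
    using infdist_attains_inf[OF W] by metis
  fix x y z :: ext_quot and r s :: real
  show "x + y + z = x + (y + z)"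
    by transfer (auto simp: eq_mod_W_def algebra_simps)
  show "x + y = y + x"
    by transfer (auto simp: eq_mod_W_def algebra_simps)
  show "0 + x = x"
    by transfer (auto simp: eq_mod_W_def)
  show "- x + x = 0"
    by transfer (auto simp: eq_mod_W_def)
  show "x - y = x + - y"
    by transfer (auto simp: eq_mod_W_def)
  show "r *\<^sub>R (x + y) = r *\<^sub>R x + r *\<^sub>R y"
    by transfer (auto simp: eq_mod_W_def scaleR_add_right)
  show "(r + s) *\<^sub>R x = r *\<^sub>R x + s *\<^sub>R x"
    by transfer (auto simp: eq_mod_W_def scaleR_add_left)
  show "r *\<^sub>R s *\<^sub>R x = (r * s) *\<^sub>R x"
    by transfer (auto simp: eq_mod_W_def)
  show "1 *\<^sub>R x = x"
    by transfer (auto simp: eq_mod_W_def)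
  show "dist x y = norm (x - y)" by (simp add: dist_ext_quot_def)
  show "sgn x = inverse (norm x) *\<^sub>R x" by (simp add: sgn_ext_quot_def)
  show "(uniformity :: (ext_quot \<times> ext_quot) filter) = (INF e\<in>{0<..}. principal {(x, y). dist x y < e})"
    by (simp add: uniformity_ext_quot_def)
  show "open U \<longleftrightarrow> (\<forall>x\<in>U. \<forall>\<^sub>F (x', y) in uniformity. x' = x \<longrightarrow> y \<in> U)" for U :: "ext_quot set"
    by (simp add: open_ext_quot_def)
  show "norm x = 0 \<longleftrightarrow> x = 0"
    by transfer (use in_closed_iff_infdist_zero[OF W] in \<open>auto simp: eq_mod_W_def\<close>)
  show "norm (x + y) \<le> norm x + norm y"
  proof transfer
    fix A B
    obtain C D where "C \<in> W" "D \<in> W" "infdist A W = dist A C" "infdist B W = dist B D"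
      using att by metis
    moreover from this have "infdist (A + B) W \<le> dist (A + B) (C + D)"
      by (intro infdist_le) auto
    ultimately show "infdist (A + B) W \<le> infdist A W + infdist B W"
      using dist_triangle_add[of A B C D] by simp
  qed
  show "norm (r *\<^sub>R x) = \<bar>r\<bar> * norm x"
  proof transfer
    fix r :: real and A
    have le: "infdist (r *\<^sub>R A) W \<le> \<bar>r\<bar> * infdist A W" for r A
    proof -
      obtain C where "C \<in> W" "infdist A W = dist A C" using att by metis
      moreover from this have "infdist (r *\<^sub>R A) W \<le> dist (r *\<^sub>R A) (r *\<^sub>R C)"
        by (intro infdist_le) auto
      moreover have "dist (r *\<^sub>R A) (r *\<^sub>R C) = \<bar>r\<bar> * dist A C"
        by (simp add: dist_norm flip: scaleR_diff_right)
      ultimately show ?thesis by simp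
    qed
    show "infdist (r *\<^sub>R A) W = \<bar>r\<bar> * infdist A W"
    proof (cases "r = 0")
      case True
      then show ?thesis using in_closed_iff_infdist_zero[OF W, of 0] by simp
    next
      case False
      have "\<bar>r\<bar> * infdist A W \<le> infdist (r *\<^sub>R A) W"
        using le[of "inverse r" "r *\<^sub>R A"] False by (simp add: field_simps)
      with le[of r A] show ?thesis by simp
    qed
  qed
qed

end

lift_definition wedge_mod_W :: "real^5 \<Rightarrow> real^5 \<Rightarrow> ext_quot" is wedge
  by (simp add: eq_mod_W_def wedge_in_exterior_square subspace_0 subspace_W)


section \<open>The Lie algebra\<close>

type_synonym lie_alg = "(real^5) \<times> ext_quot"

definition bracket :: "lie_alg \<Rightarrow> lie_alg \<Rightarrow> lie_alg" where
  "bracket x y = (0, wedge_mod_W (fst x) (fst y))"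

lemma bilinear_wedge_mod_W: "bilinear wedge_mod_W"
proof -
  have [simp]: "eq_mod_W A A \<longleftrightarrow> A \<in> exterior_square" for A
    by (simp add: eq_mod_W_def subspace_0 subspace_W)
  have 1: "wedge_mod_W (u + v) w = wedge_mod_W u w + wedge_mod_W v w" for u v w
  proof transfer
    fix u v w :: "real^5"
    have "wedge (u + v) w = wedge u w + wedge v w"
      by (simp add: wedge_def vec_eq_iff algebra_simps)
    then show "eq_mod_W (wedge (u + v) w) (wedge u w + wedge v w)"
      by (metis \<open>eq_mod_W _ _ \<longleftrightarrow> _\<close> wedge_in_exterior_square)
  qed
  have 2: "wedge_mod_W (r *\<^sub>R u) w = r *\<^sub>R wedge_mod_W u w" for r u w
  proof transfer
    fix r and u w :: "real^5"
    have "wedge (r *\<^sub>R u) w = r *\<^sub>R wedge u w"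
      by (simp add: wedge_def vec_eq_iff algebra_simps)
    then show "eq_mod_W (wedge (r *\<^sub>R u) w) (r *\<^sub>R wedge u w)"
      by (metis \<open>eq_mod_W _ _ \<longleftrightarrow> _\<close> wedge_in_exterior_square)
  qed
  have 3: "wedge_mod_W u v = - wedge_mod_W v u" for u v
  proof transfer
    fix u v :: "real^5"
    have "wedge u v = - wedge v u"
      by (simp add: wedge_def vec_eq_iff algebra_simps)
    then show "eq_mod_W (wedge u v) (- wedge v u)"
      by (metis \<open>eq_mod_W _ _ \<longleftrightarrow> _\<close> wedge_in_exterior_square)
  qed
  show ?thesis
    unfolding bilinear_def
  proof (intro conjI allI linearI)
    fix x a b and r :: real
    show "wedge_mod_W x (a + b) = wedge_mod_W x a + wedge_mod_W x b"
      using 3[of x "a + b"] 3[of x a] 3[of x b] by (simp add: 1)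
    show "wedge_mod_W x (r *\<^sub>R a) = r *\<^sub>R wedge_mod_W x a"
      using 3[of x "r *\<^sub>R a"] 3[of x a] by (simp add: 2)
  qed (simp_all add: 1 2)
qed

lemma wedge_mod_W_self: "wedge_mod_W v v = 0"
proof transfer
  fix v :: "real^5"
  have "wedge v v = 0" by (simp add: wedge_def vec_eq_iff)
  then show "eq_mod_W (wedge v v) 0"
    by (simp add: eq_mod_W_def subspace_0 subspace_W subspace_exterior_square)
qed

lemma bilinear_bracket: "bilinear bracket"
  using bilinear_wedge_mod_W
  by (auto simp: bilinear_def bracket_def linear_iff)

lemma bracket_self: "bracket x x = 0"
  by (simp add: bracket_def wedge_mod_W_self zero_prod_def)

lemma bracket_bracket: "bracket x (bracket y z) = 0"
  using bilinear_rzero[OF bilinear_wedge_mod_W] by (simp add: bracket_def zero_prod_def)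

lemma bracket_on_V: "bracket (v, 0) (w, 0) = (0, wedge_mod_W v w)"
  by (simp add: bracket_def)

lemma bracket_V': "bracket x (0, y) = 0"
  using bilinear_rzero[OF bilinear_wedge_mod_W] by (simp add: bracket_def zero_prod_def)


section \<open>The simply connected nilpotent Lie group\<close>

text \<open>
  The simply connected nilpotent Lie group of a nilpotent Lie algebra is realised, as usual, on
  the Lie algebra itself by the Baker--Campbell--Hausdorff product, the exponential map being the
  identity.  For a 2-step nilpotent Lie algebra the series stops after the first bracket.  The
  lemmas below confirm that this is a simply connected group with differentiable operations whose
  Lie algebra (the tangent space at the unit, with the bracket obtained by differentiating the
  adjoint representation) is the given one.
\<close>

definition G :: "lie_alg monoid" where
  "G = \<lparr>carrier = UNIV, mult = (\<lambda>x y. x + y + (1/2) *\<^sub>R bracket x y), one = 0\<rparr>"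

lemma group_G: "group G"
proof (rule groupI)
  note b = bilinear_ladd[OF bilinear_bracket] bilinear_radd[OF bilinear_bracket]
    bilinear_lmul[OF bilinear_bracket] bilinear_rmul[OF bilinear_bracket]
    bilinear_lzero[OF bilinear_bracket] bilinear_rzero[OF bilinear_bracket]
    bilinear_lneg[OF bilinear_bracket]
  have bb: "bracket (bracket x y) z = 0" for x y z
    using bilinear_lzero[OF bilinear_wedge_mod_W] by (simp add: bracket_def zero_prod_def)
  show "x \<otimes>\<^bsub>G\<^esub> y \<otimes>\<^bsub>G\<^esub> z = x \<otimes>\<^bsub>G\<^esub> (y \<otimes>\<^bsub>G\<^esub> z)" for x y z
    by (simp add: G_def b bb bracket_bracket algebra_simps)
  show "\<exists>y\<in>carrier G. y \<otimes>\<^bsub>G\<^esub> x = \<one>\<^bsub>G\<^esub>" for x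
    by (rule bexI[of _ "- x"]) (simp_all add: G_def b bracket_self)
qed (simp_all add: G_def bilinear_lzero[OF bilinear_bracket])

lemma inv_G: "inv\<^bsub>G\<^esub> x = - x"
  by (rule group.inv_equality[OF group_G])
     (simp_all add: G_def bilinear_lneg[OF bilinear_bracket] bracket_self)

lemma simply_connected_G: "simply_connected (carrier G)"
  by (simp add: G_def convex_imp_simply_connected)

lemma bounded_bilinear_bracket: "bounded_bilinear bracket"
proof -
  have "bounded_bilinear wedge_mod_W"
  proof -
    interpret wedge: bounded_bilinear "wedge :: real^5 \<Rightarrow> _"
    proof -
      have "bilinear (wedge :: real^5 \<Rightarrow> _)"
        by (auto simp: bilinear_def linear_iff wedge_def vec_eq_iff algebra_simps)
      then show "bounded_bilinear (wedge :: real^5 \<Rightarrow> _)"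
        by (simp add: bilinear_conv_bounded_bilinear)
    qed
    obtain K where K: "\<And>v w. norm (wedge v w :: real^5^5) \<le> norm v * norm w * K"
      using wedge.bounded by blast
    have "norm (wedge_mod_W v w) \<le> norm (wedge v w)" for v w
      by transfer (use infdist_le[OF subspace_0[OF subspace_W]] in \<open>simp add: dist_norm\<close>)
    then have "norm (wedge_mod_W v w) \<le> norm v * norm w * K" for v w
      using K order_trans by blast
    then show ?thesis
      by (unfold_locales)
         (use bilinear_wedge_mod_W in \<open>auto simp: bilinear_def linear_iff\<close>)
  qed
  then interpret w: bounded_bilinear wedge_mod_W .
  have "bounded_bilinear (\<lambda>(x :: lie_alg) (y :: lie_alg). wedge_mod_W (fst x) (fst y))"
    by (intro w.comp bounded_linear_fst)
  then interpret c: bounded_bilinear "\<lambda>(x :: lie_alg) (y :: lie_alg). wedge_mod_W (fst x) (fst y)" .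
  obtain K where K: "\<And>(x :: lie_alg) (y :: lie_alg). norm (wedge_mod_W (fst x) (fst y)) \<le> norm x * norm y * K"
    using c.bounded by blast
  have "norm (bracket x y) \<le> norm x * norm y * K" for x y :: lie_alg
    using K[of x y] by (simp add: bracket_def)
  then show ?thesis
    by unfold_locales
       (use bilinear_bracket in \<open>simp_all only: bilinear_def linear_iff, blast+\<close>)
qed

lemma has_derivative_mult_G:
  "((\<lambda>p. fst p \<otimes>\<^bsub>G\<^esub> snd p) has_derivative
    (\<lambda>h. fst h + snd h + (1/2) *\<^sub>R (bracket (fst p) (snd h) + bracket (fst h) (snd p)))) (at p)"
  unfolding G_def
  by (auto intro!: derivative_eq_intros bounded_bilinear.FDERIV[OF bounded_bilinear_bracket])

lemma has_derivative_inv_G: "(m_inv G has_derivative uminus) (at x)"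
proof -
  have "m_inv G = uminus" by (simp add: fun_eq_iff inv_G)
  then show ?thesis by (auto intro!: derivative_eq_intros)
qed

lemma one_parameter_subgroup_G: "(s *\<^sub>R x) \<otimes>\<^bsub>G\<^esub> (t *\<^sub>R x) = (s + t) *\<^sub>R x"
  by (simp add: G_def bilinear_lmul[OF bilinear_bracket] bilinear_rmul[OF bilinear_bracket]
      bracket_self scaleR_add_left)

text \<open>The adjoint representation is \<open>Ad g x = x + [g, x]\<close>, and its differential at the unit
  is \<open>ad h x = [h, x]\<close>.\<close>

lemma conjugation_G: "g \<otimes>\<^bsub>G\<^esub> x \<otimes>\<^bsub>G\<^esub> inv\<^bsub>G\<^esub> g = x + bracket g x"
proof -
  have neg: "bracket x g = - bracket g x"
    using bracket_self[of "x + g"]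
      bilinear_ladd[OF bilinear_bracket, of x g "x + g"]
      bilinear_radd[OF bilinear_bracket, of x x g] bilinear_radd[OF bilinear_bracket, of g x g]
      bracket_self[of x] bracket_self[of g]
    by (metis add.left_neutral add.right_neutral eq_neg_iff_add_eq_0)
  have bb: "bracket (bracket x y) z = 0" for x y z
    using bilinear_lzero[OF bilinear_wedge_mod_W] by (simp add: bracket_def zero_prod_def)
  have half: "(1/2) *\<^sub>R b + (1/2) *\<^sub>R b = b" for b :: lie_alg
    by (simp flip: scaleR_add_left)
  show ?thesis
    using half[of "bracket g x"]
    by (simp add: inv_G, simp add: G_def bilinear_ladd[OF bilinear_bracket]
        bilinear_rneg[OF bilinear_bracket] bilinear_lmul[OF bilinear_bracket]
        bb bracket_self neg algebra_simps)
qed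

definition Ad_G :: "lie_alg \<Rightarrow> lie_alg \<Rightarrow> lie_alg" where
  "Ad_G g = frechet_derivative (\<lambda>x. g \<otimes>\<^bsub>G\<^esub> x \<otimes>\<^bsub>G\<^esub> inv\<^bsub>G\<^esub> g) (at \<one>\<^bsub>G\<^esub>)"

lemma Ad_G_eq: "Ad_G g x = x + bracket g x"
proof -
  have "bounded_linear (\<lambda>x. x + bracket g x)"
    by (intro bounded_linear_add bounded_linear_ident
        bounded_bilinear.bounded_linear_right[OF bounded_bilinear_bracket])
  then have "((\<lambda>x. x + bracket g x) has_derivative (\<lambda>x. x + bracket g x)) (at \<one>\<^bsub>G\<^esub>)"
    by (rule bounded_linear_imp_has_derivative)
  from frechet_derivative_at[OF this] show ?thesis
    by (metis (no_types, lifting) Ad_G_def conjugation_G ext)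
qed

lemma Lie_bracket_G: "((\<lambda>g. Ad_G g x) has_derivative (\<lambda>h. bracket h x)) (at \<one>\<^bsub>G\<^esub>)"
  unfolding Ad_G_eq
  by (rule has_derivative_eq_rhs,
      rule has_derivative_add[OF has_derivative_const bounded_linear_imp_has_derivative],
      rule bounded_bilinear.bounded_linear_left[OF bounded_bilinear_bracket]) simp


section \<open>Continuous automorphisms\<close>

definition Aut :: "('a::topological_space, 'b) monoid_scheme \<Rightarrow> ('a \<Rightarrow> 'a) monoid" where
  "Aut H = AutoGroup H \<lparr>carrier := {f \<in> auto H. continuous_on (carrier H) f}\<rparr>"

end

theory Submission
  imports Defs "HOL-Library.Quadratic_Discriminant"
begin

text \<open>
  A continuous automorphism of \<open>G\<close> acts on \<open>V = G/[G,G]\<close> by a linear map \<open>A\<close> that preserves \<open>W\<close>.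
  View the elements of \<open>W\<close> as alternating forms on \<open>V\<^sup>*\<close>: every nonzero \<open>M \<in> W\<close> has a kernel line
  in \<open>V\<^sup>*\<close>, spanned by \<open>M \<and> M\<close>, so it is an \<open>A\<close>-invariant condition on \<open>v \<in> V\<close> that \<open>v\<close>
  annihilates the kernel of some nonzero \<open>M \<in> W\<close>.  It says that the quadratic form
  \<open>M \<mapsto> v \<and> M \<and> M\<close> on the 3-dimensional space \<open>W\<close> has a nontrivial zero, that is, it is not
  definite.  Both the vectors giving definite forms and those giving indefinite forms have
  interior points, so no orbit can be dense.
\<close>

section \<open>Indices modulo 5\<close>

lemma exhaust_5: "x = 1 \<or> x = 2 \<or> x = 3 \<or> x = 4 \<or> x = 5" for x :: 5
proof (induct x)
  case (of_int z)
  \<comment> \<open>The residue 0 is the numeral \<open>5\<close>, so it accounts for the last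
    alternative.\<close>
  then have "z = 0 \<or> z = 1 \<or> z = 2 \<or> z = 3 \<or> z = 4" by fastforce
  then show ?case by auto
qed

lemma UNIV_5: "UNIV = {1, 2, 3, 4, 5 :: 5}"
  using exhaust_5 by auto

lemma sum_5: "sum f (UNIV :: 5 set) = f 1 + f 2 + f 3 + f 4 + f 5"
  unfolding UNIV_5 by (simp add: ac_simps)

lemma forall_5: "(\<forall>i::5. P i) \<longleftrightarrow> P 1 \<and> P 2 \<and> P 3 \<and> P 4 \<and> P 5"
  by (metis exhaust_5)


section \<open>Degenerate vectors\<close>

definition W_elem :: "real \<Rightarrow> real \<Rightarrow> real \<Rightarrow> real^5^5" where
  "W_elem a b c = a *\<^sub>R (wedge (\<sigma> 1) (\<sigma> 4) - wedge (\<sigma> 2) (\<sigma> 3))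
    + b *\<^sub>R (wedge (\<sigma> 1) (\<sigma> 5) - wedge (\<sigma> 2) (\<sigma> 4))
    + c *\<^sub>R (wedge (\<sigma> 2) (\<sigma> 5) - wedge (\<sigma> 3) (\<sigma> 4))"

lemma W_eq: "W = {W_elem a b c | a b c. True}"
proof -
  have "x - a *\<^sub>R p - b *\<^sub>R q - c *\<^sub>R r = 0 \<longleftrightarrow> x = a *\<^sub>R p + b *\<^sub>R q + c *\<^sub>R r"
    for x p q r :: "real^5^5" and a b c
    by (auto simp: algebra_simps)
  then show ?thesis
    unfolding W_def W_elem_def span_insert span_empty by simp
qed

lemma W_elem_mult_eq_0_iff:
  "W_elem a b c *v y = 0 \<longleftrightarrow>
    a * y$4 + b * y$5 = 0 \<and>
    a * y$3 + b * y$4 = c * y$5 \<and>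
    a * y$2 = c * y$4 \<and>
    b * y$2 + c * y$3 = a * y$1 \<and>
    b * y$1 + c * y$2 = 0"
  by (auto simp: vec_eq_iff forall_5 matrix_vector_mult_def sum_5 W_elem_def wedge_def \<sigma>_def axis_def)

lemma W_elem_eq_0_iff: "W_elem a b c = 0 \<longleftrightarrow> a = 0 \<and> b = 0 \<and> c = 0"
  by (auto simp: vec_eq_iff forall_5 W_elem_def wedge_def \<sigma>_def axis_def)

lemma matrix_add_rdistrib: "(A + B) ** C = A ** C + B ** C"
  for A B :: "'a::semiring_1^'n^'m" and C :: "'a^'k^'n"
  by (simp add: vec_eq_iff matrix_matrix_mult_def distrib_right sum.distrib)

text \<open>Congruence by \<open>A\<close> is the map that \<open>A\<close> induces on the exterior
  square, as \<open>wedge_mult\<close> shows.\<close>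

lemma exterior_square_congruence:
  fixes A M :: "real^'n^'n"
  assumes "M \<in> exterior_square"
  shows "A ** M ** transpose A \<in> exterior_square"
proof -
  have "transpose M = - M" using assms by (simp add: exterior_square_eq_skew)
  then show ?thesis
    by (simp add: exterior_square_eq_skew matrix_transpose_mul matrix_mul_assoc)
      (simp add: vec_eq_iff matrix_matrix_mult_def sum_negf)
qed

text \<open>Here \<open>y\<close> is a covector, paired with \<open>v\<close> by the inner product.
  One nonzero kernel vector is enough, since by \<open>kernel_W_elem\<close> the kernel of a nonzero
  element of \<open>W\<close> has dimension at most one.\<close>

definition degenerate :: "real^5 \<Rightarrow> bool" where
  "degenerate v \<longleftrightarrow> (\<exists>M\<in>W. \<exists>y. M \<noteq> 0 \<and> y \<noteq> 0 \<and> M *v y = 0 \<and> v \<bullet> y = 0)"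

text \<open>On the slice \<open>b = 0\<close>, \<open>c = 1\<close> of \<open>W\<close> the
  quadratic form becomes the polynomial \<open>v$5 * a^2 + v$3 * a + v$1\<close>. Its outer
  coefficients have opposite signs, so it has a real root \<open>a\<close>, and \<open>y\<close> is
  a kernel vector of \<open>W_elem a 0 1\<close>.\<close>

lemma degenerate_if_opposite_signs:
  assumes "v$1 > 0" "v$5 < 0"
  shows "degenerate v"
proof -
  define D where "D = (v$3)\<^sup>2 - 4 * v$5 * v$1"
  have "v$5 * v$1 < 0" using assms by (simp add: mult_neg_pos)
  then have D: "D \<ge> 0" unfolding D_def using zero_le_power2[of "v$3"] by linarith
  define a where "a = (- v$3 + sqrt D) / (2 * v$5)"
  have "v$5 * a\<^sup>2 + v$3 * a + v$1 = 0"
    using discriminant_nonneg[of "v$5" "v$3" "v$1" a] D assms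
    by (simp add: discrim_def D_def a_def)
  moreover define y :: "real^5" where
    "y = (\<chi> i. if i = 1 then 1 else if i = 3 then a else if i = 5 then a\<^sup>2 else 0)"
  ultimately have "v \<bullet> y = 0"
    by (simp add: inner_vec_def sum_5 algebra_simps)
  moreover have "W_elem a 0 1 *v y = 0"
    by (simp add: W_elem_mult_eq_0_iff y_def power2_eq_square)
  moreover have "y \<noteq> 0" by (auto simp: vec_eq_iff forall_5 y_def)
  moreover have "W_elem a 0 1 \<noteq> 0" by (simp add: W_elem_eq_0_iff)
  moreover have "W_elem a 0 1 \<in> W" by (auto simp: W_eq)
  ultimately show ?thesis unfolding degenerate_def by blast
qed

text \<open>The vector multiplied by \<open>l\<close> consists, up to a common factor, of the coordinates of
  \<open>M \<and> M\<close> for \<open>M = W_elem a b c\<close>.\<close>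

lemma kernel_W_elem:
  assumes "W_elem a b c *v y = 0" "W_elem a b c \<noteq> 0"
  obtains l where "y$1 = l * c\<^sup>2" "y$2 = - l * b * c" "y$3 = l * (b\<^sup>2 + a * c)"
    "y$4 = - l * a * b" "y$5 = l * a\<^sup>2"
proof -
  note * = assms(1)[unfolded W_elem_mult_eq_0_iff]
  \<comment> \<open>The factor \<open>l\<close> is read off a coordinate that cannot vanish:
    \<open>a^2\<close>, else \<open>c^2\<close>, else \<open>b^2\<close>. The equations then give
    the other coordinates one after the other.\<close>
  consider "a \<noteq> 0" | "a = 0" "c \<noteq> 0" | "a = 0" "c = 0" "b \<noteq> 0"
    using assms(2) by (auto simp: W_elem_eq_0_iff)
  then show thesis
  proof cases
    case 1
    define l where "l = y$5 / a\<^sup>2"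
    have 5: "y$5 = l * a\<^sup>2" using 1 by (simp add: l_def)
    have "a * y$4 = a * (- l * a * b)" using * 5 by (simp add: power2_eq_square algebra_simps)
    then have 4: "y$4 = - l * a * b" using mult_left_cancel[OF 1] by blast
    have "a * y$3 = a * (l * (b\<^sup>2 + a * c))" using * 4 5 by (simp add: power2_eq_square algebra_simps)
    then have 3: "y$3 = l * (b\<^sup>2 + a * c)" using mult_left_cancel[OF 1] by blast
    have "a * y$2 = a * (- l * b * c)" using * 4 by (simp add: algebra_simps)
    then have 2: "y$2 = - l * b * c" using mult_left_cancel[OF 1] by blast
    have "a * y$1 = b * y$2 + c * y$3" using * by simp
    also have "\<dots> = a * (l * c\<^sup>2)" unfolding 2 3 by (simp add: power2_eq_square algebra_simps)
    finally have "y$1 = l * c\<^sup>2" using mult_left_cancel[OF 1] by blast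
    with 2 3 4 5 show thesis using that by blast
  next
    case 2
    define l where "l = y$1 / c\<^sup>2"
    have 1: "y$1 = l * c\<^sup>2" using 2 by (simp add: l_def)
    have "c * y$2 = c * (- l * b * c)" using * 1 by (simp add: power2_eq_square algebra_simps)
    then have y2: "y$2 = - l * b * c" using mult_left_cancel[OF 2(2)] by blast
    have "c * y$3 = c * (l * b\<^sup>2)" using * y2 2 by (simp add: power2_eq_square algebra_simps)
    then have y3: "y$3 = l * b\<^sup>2" using mult_left_cancel[OF 2(2)] by blast
    have "y$4 = 0" using * 2 by simp
    moreover from this have "y$5 = 0" using * 2 by simp
    ultimately show thesis using that[of l] 1 2 y2 y3 by simp
  next
    case 3
    then show thesis using that[of "y$3 / b\<^sup>2"] * by simp
  qed
qed

text \<open>At \<open>\<sigma> 1 + \<sigma> 3 + \<sigma> 5\<close> the form is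
  \<open>a^2 + b^2 + c^2 + a * c\<close>, which is positive definite; the bounds are small enough to
  keep it so.\<close>

lemma not_degenerate_near:
  assumes v: "\<bar>v$1 - 1\<bar> < 1/4" "\<bar>v$2\<bar> < 1/10" "\<bar>v$3 - 1\<bar> < 1/4" "\<bar>v$4\<bar> < 1/10" "\<bar>v$5 - 1\<bar> < 1/4"
  shows "\<not> degenerate v"
proof
  assume "degenerate v"
  then obtain a b c y where M: "W_elem a b c \<noteq> 0" "W_elem a b c *v y = 0"
    and y: "y \<noteq> 0" "v \<bullet> y = 0"
    unfolding degenerate_def W_eq by blast
  obtain l where l: "y$1 = l * c\<^sup>2" "y$2 = - l * b * c" "y$3 = l * (b\<^sup>2 + a * c)"
    "y$4 = - l * a * b" "y$5 = l * a\<^sup>2"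
    using kernel_W_elem[OF M(2,1)] .
  \<comment> \<open>Up to a constant factor, \<open>F\<close> is the form v \<and> M \<and> M in the
    coordinates of \<open>W\<close>; pairing \<open>v\<close> with the kernel vector gives
    \<open>l * F\<close>.\<close>
  define F where "F = v$5 * a\<^sup>2 + v$3 * b\<^sup>2 + v$1 * c\<^sup>2 + v$3 * (a * c) - v$4 * (a * b) - v$2 * (b * c)"
  have "l * F = 0" using y(2) by (simp add: F_def inner_vec_def sum_5 l algebra_simps)
  moreover have "l \<noteq> 0" using y(1) l by (auto simp: vec_eq_iff forall_5)
  ultimately have "F = 0" by simp
  have prod: "\<bar>s * t\<bar> \<le> (s\<^sup>2 + t\<^sup>2) / 2" for s t :: real
    using sum_squares_bound[of "\<bar>s\<bar>" "\<bar>t\<bar>"] by (simp add: abs_mult)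
  have bound: "\<bar>x * (s * t)\<bar> \<le> e * ((s\<^sup>2 + t\<^sup>2) / 2)" if "\<bar>x\<bar> \<le> e" for x e s t :: real
    unfolding abs_mult[of x] by (rule mult_mono) (use that prod in auto)
  have "v$5 * a\<^sup>2 \<ge> 3/4 * a\<^sup>2" "v$3 * b\<^sup>2 \<ge> 3/4 * b\<^sup>2" "v$1 * c\<^sup>2 \<ge> 3/4 * c\<^sup>2"
    by (rule mult_right_mono; use v in \<open>simp only: zero_le_power2, linarith?\<close>)+
  moreover have "\<bar>v$3 * (a * c)\<bar> \<le> 5/4 * ((a\<^sup>2 + c\<^sup>2) / 2)"
    "\<bar>v$4 * (a * b)\<bar> \<le> 1/10 * ((a\<^sup>2 + b\<^sup>2) / 2)" "\<bar>v$2 * (b * c)\<bar> \<le> 1/10 * ((b\<^sup>2 + c\<^sup>2) / 2)"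
    by (rule bound; use v in linarith)+
  \<comment> \<open>What remains is \<open>3/4 - 5/8 - 1/20 = 3/40\<close> for \<open>a^2\<close>
    and \<open>c^2\<close>, and \<open>3/4 - 1/10 = 13/20\<close> for \<open>b^2\<close>; all exceed
    \<open>1/20\<close>.\<close>
  ultimately have "F \<ge> (a\<^sup>2 + b\<^sup>2 + c\<^sup>2) / 20"
    unfolding F_def using zero_le_power2[of a] zero_le_power2[of b] zero_le_power2[of c]
    by argo
  moreover have "a\<^sup>2 + b\<^sup>2 + c\<^sup>2 > 0"
    using M(1) by (auto simp: W_elem_eq_0_iff add_pos_nonneg add_nonneg_pos)
  ultimately show False using \<open>F = 0\<close> by simp
qed

section \<open>Invariance of degeneracy under congruences respecting \<open>W\<close>\<close>

text \<open>If \<open>y\<close> is a kernel vector of \<open>M\<close> and \<open>B\<close> inverts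
  \<open>A\<close>, then \<open>transpose B *v y\<close> is one of
  \<open>A ** M ** transpose A\<close>, and its pairing with \<open>A *v v\<close> is that of
  \<open>y\<close> with \<open>v\<close>. The converse transports back with
  \<open>B\<close>.\<close>

lemma degenerate_congruence_iff:
  fixes A :: "real^5^5"
  assumes A: "invertible A"
    and W: "\<And>M. M \<in> exterior_square \<Longrightarrow> A ** M ** transpose A \<in> W \<longleftrightarrow> M \<in> W"
  shows "degenerate (A *v v) \<longleftrightarrow> degenerate v"
proof
  have dot: "(A *v v) \<bullet> y = v \<bullet> (transpose A *v y)" for y
    by (metis dot_lmul_matrix inner_commute transpose_matrix_vector)
  obtain B where B: "A ** B = mat 1" "B ** A = mat 1" using A by (auto simp: invertible_def)
  then have B': "transpose A ** transpose B = mat 1" "transpose B ** transpose A = mat 1"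
    by (metis matrix_transpose_mul transpose_mat)+
  have inj: "M = 0" if "A ** M ** transpose A = 0" for M
  proof -
    have "M = B ** (A ** M ** transpose A) ** transpose B"
      using B B' by (metis matrix_mul_assoc matrix_mul_lid matrix_mul_rid)
    then show ?thesis using that by simp
  qed
  show "degenerate (A *v v)" if v: "degenerate v"
  proof -
    obtain M y where M: "M \<in> W" "M \<noteq> 0" "y \<noteq> 0" "M *v y = 0" "v \<bullet> y = 0"
      using v unfolding degenerate_def by blast
    have Ay: "transpose A *v (transpose B *v y) = y"
      by (metis B'(1) matrix_vector_mul_assoc matrix_vector_mul_lid)
    let ?M = "A ** M ** transpose A" and ?y = "transpose B *v y"
    have "?M \<in> W" using W M(1) W_subset_exterior_square by blast
    moreover have "?M \<noteq> 0" using inj M(2) by blast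
    moreover have "?M *v ?y = A *v (M *v (transpose A *v ?y))"
      by (simp only: matrix_vector_mul_assoc matrix_mul_assoc)
    then have "?M *v ?y = 0" unfolding Ay using M by simp
    moreover have "(A *v v) \<bullet> ?y = 0" unfolding dot Ay using M by simp
    moreover have "?y \<noteq> 0" using Ay M(3) by (metis matrix_vector_mult_0_right)
    ultimately show ?thesis unfolding degenerate_def by blast
  qed
  show "degenerate v" if v: "degenerate (A *v v)"
  proof -
    obtain M y where M: "M \<in> W" "M \<noteq> 0" "y \<noteq> 0" "M *v y = 0" "(A *v v) \<bullet> y = 0"
      using v unfolding degenerate_def by blast
    let ?M = "B ** M ** transpose B" and ?y = "transpose A *v y"
    have AM: "A ** ?M ** transpose A = M"
      using B B' by (metis matrix_mul_assoc matrix_mul_lid matrix_mul_rid)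
    have "?M \<in> exterior_square"
      using exterior_square_congruence M(1) W_subset_exterior_square by blast
    \<comment> \<open>Congruence by \<open>A\<close> takes \<open>?M\<close> to \<open>M\<close>, so
      the equivalence assumed for \<open>W\<close> is read from left to right.\<close>
    then have "?M \<in> W" using W AM M(1) by metis
    moreover have "?M \<noteq> 0" using AM M(2) by force
    moreover have "?M *v ?y = 0" "?y \<noteq> 0"
    proof -
      have By: "transpose B *v ?y = y"
        by (metis B'(2) matrix_vector_mul_assoc matrix_vector_mul_lid)
      have "?M *v ?y = B *v (M *v (transpose B *v ?y))"
        by (simp only: matrix_vector_mul_assoc matrix_mul_assoc)
      then show "?M *v ?y = 0" unfolding By using M by simp
      show "?y \<noteq> 0" using By M(3) by (metis matrix_vector_mult_0_right)
    qed
    moreover have "v \<bullet> ?y = 0" using M(5) unfolding dot .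
    ultimately show ?thesis unfolding degenerate_def by blast
  qed
qed

section \<open>Continuous automorphisms\<close>

text \<open>Additivity gives homogeneity for rational scalars. The scalars for which it holds form a
  closed set, so density of the rationals gives all reals.\<close>

lemma additive_continuous_imp_linear:
  fixes f :: "'a::real_normed_vector \<Rightarrow> 'b::real_normed_vector"
  assumes add: "\<And>x y. f (x + y) = f x + f y" and cont: "continuous_on UNIV f"
  shows "linear f"
proof
  interpret additive f by unfold_locales (rule add)
  have nat: "f (of_nat n *\<^sub>R x) = of_nat n *\<^sub>R f x" for n x
    by (induction n) (simp_all add: zero add scaleR_add_left)
  have int: "f (of_int n *\<^sub>R x) = of_int n *\<^sub>R f x" for n x
    by (cases n) (simp_all add: nat minus flip: of_nat_Suc del: of_nat_Suc)
  have rat: "f (r *\<^sub>R x) = r *\<^sub>R f x" if "r \<in> \<rat>" for r x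
  proof -
    obtain p q where q: "q > 0" and r: "r = of_int p / of_int q"
      using \<open>r \<in> \<rat>\<close> by (metis Rats_cases')
    have "of_int q *\<^sub>R f (r *\<^sub>R x) = of_int p *\<^sub>R f x"
      using int[of q "r *\<^sub>R x"] int[of p x] q by (simp add: r)
    then have "(1 / of_int q) *\<^sub>R of_int q *\<^sub>R f (r *\<^sub>R x) = r *\<^sub>R f x"
      by (simp add: r)
    then show ?thesis using q by simp
  qed
  show "f (r *\<^sub>R x) = r *\<^sub>R f x" for r x
  proof -
    have "closed {r. f (r *\<^sub>R x) = r *\<^sub>R f x}"
      by (intro closed_Collect_eq continuous_on_compose2[OF cont] continuous_intros) auto
    then have "closure \<rat> \<subseteq> {r. f (r *\<^sub>R x) = r *\<^sub>R f x}"
      using rat by (intro closure_minimal) auto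
    then show ?thesis by (auto simp: Rats_closure_real)
  qed
qed (rule add)

section \<open>The action of an automorphism on V and V'\<close>

text \<open>The projection of the exterior square onto V'. The default 0 on other matrices makes it
  a total function although \<open>eq_mod_W\<close> is a partial relation.\<close>

lift_definition mod_W :: "real^5^5 \<Rightarrow> ext_quot" is "\<lambda>M. if M \<in> exterior_square then M else 0"
  by (auto simp: eq_mod_W_def subspace_0 subspace_W subspace_exterior_square)

lemma mod_W_wedge: "mod_W (wedge u v) = wedge_mod_W u v"
  by transfer (simp add: eq_mod_W_def wedge_in_exterior_square subspace_0 subspace_W)

lemma mod_W_add:
  "M \<in> exterior_square \<Longrightarrow> N \<in> exterior_square \<Longrightarrow> mod_W (M + N) = mod_W M + mod_W N"
  by transfer (auto simp: eq_mod_W_def subspace_0 subspace_W subspace_exterior_square subspace_add)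

lemma mod_W_eq_0_iff: "M \<in> exterior_square \<Longrightarrow> mod_W M = 0 \<longleftrightarrow> M \<in> W"
  by transfer (auto simp: eq_mod_W_def subspace_0 subspace_W subspace_exterior_square)

lemma mod_W_surj:
  obtains M where "M \<in> exterior_square" "z = mod_W M"
proof -
  have "\<exists>M\<in>exterior_square. z = mod_W M"
    by transfer (auto simp: eq_mod_W_def subspace_0[OF subspace_W] intro!: bexI)
  then show thesis using that by blast
qed

lemma wedge_mult: "wedge (A *v u) (A *v v) = A ** wedge u v ** transpose A"
  for A :: "real^'n^'n"
proof -
  have "(A ** wedge u v) $ i $ l = (A *v u) $ i * v $ l - (A *v v) $ i * u $ l" for i l
    by (simp add: matrix_matrix_mult_def matrix_vector_mult_def wedge_def sum_subtractf
        sum_distrib_right right_diff_distrib mult.assoc)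
  moreover have "(B ** transpose A) $ i $ j = (\<Sum>l\<in>UNIV. A $ j $ l * B $ i $ l)"
    for B :: "real^'n^'n" and i j
    by (simp add: matrix_matrix_mult_def transpose_def mult.commute)
  ultimately have "(A ** wedge u v ** transpose A) $ i $ j = wedge (A *v u) (A *v v) $ i $ j" for i j
    by (simp add: wedge_def matrix_vector_mult_def[of A] right_diff_distrib sum_subtractf
        sum_distrib_left mult.left_commute)
  then show ?thesis by (simp add: vec_eq_iff)
qed

text \<open>A scalar is absorbed into the first factor of a wedge product, so no case for multiples
  arises. Additivity of an automorphism on V' is then enough, without its linearity.\<close>

lemma exterior_square_induct [consumes 1, case_names zero step]:
  assumes "M \<in> exterior_square" and "P 0"
    and "\<And>u v N. N \<in> exterior_square \<Longrightarrow> P N \<Longrightarrow> P (wedge u v + N)"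
  shows "P M"
proof -
  have "M \<in> span {wedge u v | u v. True}"
    using assms(1) by (simp add: exterior_square_def)
  then have "M \<in> exterior_square \<and> P M"
  proof (induction rule: span_induct_alt)
    case base
    show ?case using assms(2) subspace_0[OF subspace_exterior_square] by simp
  next
    case (step c x y)
    then obtain u v where "x = wedge u v" by blast
    then have x: "c *\<^sub>R x = wedge (c *\<^sub>R u) v"
      by (simp add: wedge_def vec_eq_iff right_diff_distrib mult.left_commute)
    show ?case
      unfolding x using step.IH assms(3)
      by (simp add: subspace_add[OF subspace_exterior_square] wedge_in_exterior_square)
  qed
  then show ?thesis ..
qed

text \<open>\<open>A\<close> is the map induced on V = G/[G,G]. Since \<open>f\<close> respects
  commutators, it acts on V' through congruence by \<open>A\<close>; injectivity of \<open>f\<close>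
  turns this into the equivalence for \<open>W\<close>.\<close>

lemma automorphism_acts_by_congruence:
  assumes f: "f \<in> carrier (Aut G)"
  obtains A where "invertible A" "\<And>x. fst (f x) = A *v fst x"
    "\<And>M. M \<in> exterior_square \<Longrightarrow> A ** M ** transpose A \<in> W \<longleftrightarrow> M \<in> W"
proof -
  have bij: "bij f" and cont: "continuous_on UNIV f" and "f \<in> hom G G"
    using f by (auto simp: Aut_def AutoGroup_def auto_def Bij_def G_def)
  then have hom: "f (x \<otimes>\<^bsub>G\<^esub> y) = f x \<otimes>\<^bsub>G\<^esub> f y" for x y
    by (intro hom_mult) (simp_all add: G_def)
  have inv: "f (inv\<^bsub>G\<^esub> x) = inv\<^bsub>G\<^esub> f x" for x
    using group_hom.hom_inv[of G G f x] \<open>f \<in> hom G G\<close> group_G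
    by (simp add: group_hom_def group_hom_axioms_def G_def)
  have fst_mult: "fst (x \<otimes>\<^bsub>G\<^esub> y) = fst x + fst y" for x y
    by (simp add: G_def bracket_def)
  have central: "x \<otimes>\<^bsub>G\<^esub> (0, z) = x + (0, z)" for x z
    by (simp add: G_def bracket_V')
  have f0: "f 0 = 0"
    using hom[of 0 0] by (simp add: G_def bracket_self)
  \<comment> \<open>\<open>f (u, 0)\<close> may have a component in V'; \<open>g\<close> discards
    it, and brackets do not see it.\<close>
  define g where "g u = fst (f (u, 0))" for u
  have fw: "f (0, wedge_mod_W u v) = (0, wedge_mod_W (g u) (g v))" for u v
  proof -
    \<comment> \<open>Conjugation of \<open>(v, 0)\<close> by \<open>(u, 0)\<close> adds their
      bracket, so the bracket is expressed by group operations, which \<open>f\<close> preserves.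
      Cancelling \<open>f (v, 0)\<close> isolates the value on V'.\<close>
    have "f ((v, 0) + bracket (u, 0) (v, 0)) = f (v, 0) + bracket (f (u, 0)) (f (v, 0))"
      unfolding conjugation_G[symmetric] by (simp add: hom inv)
    then have "f (v, 0) \<otimes>\<^bsub>G\<^esub> f (0, wedge_mod_W u v) = f (v, 0) \<otimes>\<^bsub>G\<^esub> (0, wedge_mod_W (g u) (g v))"
      by (simp add: central bracket_on_V bracket_def g_def flip: hom)
    then show ?thesis
      using monoid.Units_l_cancel[OF group.is_monoid[OF group_G]] group.Units_eq[OF group_G]
      by (simp add: G_def)
  qed
  have "linear g"
  proof (rule additive_continuous_imp_linear)
    show "g (u + v) = g u + g v" for u v
    proof -
      \<comment> \<open>With the factor moved inside the wedge, \<open>fw\<close> shows that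
        \<open>f\<close> maps the correction term of the product into V'.\<close>
      have half: "(1/2) *\<^sub>R wedge_mod_W u v = wedge_mod_W ((1/2) *\<^sub>R u) v"
        by (simp add: bilinear_lmul[OF bilinear_wedge_mod_W])
      have "(u, 0) \<otimes>\<^bsub>G\<^esub> (v, 0) = (u + v, 0) \<otimes>\<^bsub>G\<^esub> (0, wedge_mod_W ((1/2) *\<^sub>R u) v)"
        unfolding central by (simp add: G_def bracket_def half)
      then have "f (u, 0) \<otimes>\<^bsub>G\<^esub> f (v, 0) = f (u + v, 0) \<otimes>\<^bsub>G\<^esub> f (0, wedge_mod_W ((1/2) *\<^sub>R u) v)"
        by (metis hom)
      then have "fst (f (u, 0)) + fst (f (v, 0)) = fst (f (u + v, 0))"
        unfolding fw by (metis add.right_neutral fst_conv fst_mult)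
      then show ?thesis by (simp add: g_def)
    qed
    show "continuous_on UNIV g"
      unfolding g_def by (intro continuous_intros continuous_on_compose2[OF cont]) auto
  qed
  define A where "A = matrix g"
  have g: "g u = A *v u" for u
    using \<open>linear g\<close> by (simp add: A_def matrix_works)
  have fM: "f (0, mod_W M) = (0, mod_W (A ** M ** transpose A))" if "M \<in> exterior_square" for M
    using that
  proof (induction rule: exterior_square_induct)
    case zero
    have "mod_W 0 = 0" by (simp add: mod_W_eq_0_iff subspace_0 subspace_W subspace_exterior_square)
    then show ?case using f0 by (simp add: zero_prod_def)
  next
    case (step u v N)
    have "f (0, mod_W (wedge u v + N)) = f ((0, wedge_mod_W u v) \<otimes>\<^bsub>G\<^esub> (0, mod_W N))"
      using step(1) by (simp add: central mod_W_add mod_W_wedge wedge_in_exterior_square)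
    also have "\<dots> = (0, mod_W (wedge (g u) (g v)) + mod_W (A ** N ** transpose A))"
      unfolding hom fw step(2) by (simp add: central mod_W_wedge)
    also have "\<dots> = (0, mod_W (wedge (g u) (g v) + A ** N ** transpose A))"
      by (simp add: mod_W_add wedge_in_exterior_square exterior_square_congruence step(1))
    also have "wedge (g u) (g v) + A ** N ** transpose A = A ** (wedge u v + N) ** transpose A"
      by (simp add: g wedge_mult matrix_add_ldistrib matrix_add_rdistrib)
    finally show ?case .
  qed
  have fstf: "fst (f x) = A *v fst x" for x
  proof -
    obtain M where M: "M \<in> exterior_square" "snd x = mod_W M" by (rule mod_W_surj)
    have "x = (fst x, 0) \<otimes>\<^bsub>G\<^esub> (0, mod_W M)" by (simp add: central M(2)[symmetric])
    then have "f x = f (fst x, 0) \<otimes>\<^bsub>G\<^esub> f (0, mod_W M)" by (metis hom)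
    then have "fst (f x) = g (fst x)" by (simp add: fM M(1) fst_mult g_def)
    then show ?thesis by (simp add: g)
  qed
  have "surj ((*v) A)"
    unfolding surj_def
  proof
    fix u
    obtain x where "f x = (u, 0)" using bij by (metis bij_pointE)
    then show "\<exists>v. u = A *v v" using fstf[of x] by auto
  qed
  then have "invertible A" by (simp add: invertible_right_inverse matrix_right_invertible_surjective)
  moreover have "A ** M ** transpose A \<in> W \<longleftrightarrow> M \<in> W" if M: "M \<in> exterior_square" for M
  proof -
    have "A ** M ** transpose A \<in> W \<longleftrightarrow> f (0, mod_W M) = f 0"
      by (simp add: fM f0[unfolded zero_prod_def] M mod_W_eq_0_iff[symmetric] exterior_square_congruence zero_prod_def)
    also have "\<dots> \<longleftrightarrow> mod_W M = 0"
      using bij by (simp add: bij_def inj_eq zero_prod_def)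
    finally show ?thesis using M by (simp add: mod_W_eq_0_iff)
  qed
  ultimately show thesis using that fstf by blast
qed

section \<open>Degeneracy is constant on orbits but not on dense sets\<close>

theorem corollary3p1:
  shows "\<not> (\<exists>x \<in> carrier G. closure (orbit (Aut G) (\<lambda>f. f) x) = carrier G)"
proof
  assume "\<exists>x \<in> carrier G. closure (orbit (Aut G) (\<lambda>f. f) x) = carrier G"
  then obtain x where dense: "closure (orbit (Aut G) (\<lambda>f. f) x) = UNIV"
    by (auto simp: G_def)
  have orb: "degenerate (fst y) \<longleftrightarrow> degenerate (fst x)" if "y \<in> orbit (Aut G) (\<lambda>f. f) x" for y
  proof -
    obtain f where "f \<in> carrier (Aut G)" "y = f x" using \<open>y \<in> _\<close> by (auto simp: orbit_def)
    then show ?thesis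
      by (metis automorphism_acts_by_congruence degenerate_congruence_iff)
  qed
  have meet: "\<exists>y\<in>orbit (Aut G) (\<lambda>f. f) x. fst y \<in> U" if "open U" "u \<in> U" for U u
  proof -
    \<comment> \<open>An open subset of V, extended by all of V', is open in \<open>G\<close> and so
      meets a dense orbit.\<close>
    have "open (U \<times> (UNIV :: ext_quot set))" "(u, 0) \<in> U \<times> (UNIV :: ext_quot set)"
      using that by (auto intro: open_Times)
    then have "(U \<times> UNIV) \<inter> orbit (Aut G) (\<lambda>f. f) x \<noteq> {}"
      using dense open_Int_closure_eq_empty[of "U \<times> UNIV" "orbit (Aut G) (\<lambda>f. f) x"] by blast
    then show ?thesis by fastforce
  qed
  \<comment> \<open>These vectors have indefinite forms; those of the box \<open>?N\<close> below
    have definite ones.\<close>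
  have "open {v :: real^5. v$1 > 0 \<and> v$5 < 0}"
    by (intro open_Collect_conj open_Collect_less continuous_intros)
  moreover have "\<sigma> 1 - \<sigma> 5 \<in> {v :: real^5. v$1 > 0 \<and> v$5 < 0}"
    by (simp add: \<sigma>_def axis_def)
  ultimately obtain y where "y \<in> orbit (Aut G) (\<lambda>f. f) x" "fst y $ 1 > 0" "fst y $ 5 < 0"
    using meet by blast
  then have "degenerate (fst x)"
    using degenerate_if_opposite_signs orb by blast
  let ?N = "{v :: real^5. \<bar>v$1 - 1\<bar> < 1/4 \<and> \<bar>v$2\<bar> < 1/10 \<and> \<bar>v$3 - 1\<bar> < 1/4 \<and>
    \<bar>v$4\<bar> < 1/10 \<and> \<bar>v$5 - 1\<bar> < 1/4}"
  have "open ?N"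
    by (intro open_Collect_conj open_Collect_less continuous_intros)
  moreover have "\<sigma> 1 + \<sigma> 3 + \<sigma> 5 \<in> ?N"
    by (simp add: \<sigma>_def axis_def)
  ultimately obtain z where "z \<in> orbit (Aut G) (\<lambda>f. f) x" "fst z \<in> ?N"
    using meet by blast
  then have "\<not> degenerate (fst x)"
    using not_degenerate_near[of "fst z"] orb by blast
  with \<open>degenerate (fst x)\<close> show False by contradiction
qed

end
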